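(* Let $q$ be a prime power with $q\equiv 1\pmod 4$ and $q\not\equiv 1\pmod 3$. For every $x\in\mathbb{F}_{q^3}^{*}$, \[ \kappa_{1}(x) - \kappa_{-1}(x) = q\cdot \chi_{2}(x)\,\chi_{2}(\mathrm{T}(x)). \]
   Context: $\mathbb{E}=\mathbb{F}_{q^3}$, $\mathrm{T}(x)=x+x^q+x^{q^2}$ (trace to $\mathbb{F}_q$). Fix a primitive element $\alpha$ of $\mathbb{E}$ and put $\mu=\alpha^{q-1}$ (of order $q^2+q+1$). The quartic character $\chi_4$ of $\mathbb{E}$ is defined by $\chi_4(0)=0$, $\chi_4(\alpha^n)=\mathrm{i}^n$ with $\mathrm{i}=\sqrt{-1}\in\mathbb{C}$; $\overline{\chi_4}$ is its complex conjugate; $\chi_2=\chi_4^2$ is the quadratic character of $\mathbb{E}$ ($\chi_2(0)=0$). For $z\in\{1,\mathrm{i},-1,-\mathrm{i}\}$ and $x\in\mathbb{E}^*$, $\kappa_z(x)$ is the number of $i$ with $0\le i<q^2+q+1$ such that $\chi_4(\mathrm{T}(\mu^ix))\,\overline{\chi_4}(\mathrm{T}(\mu^{-i}x))=z$. *)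

theory Defs
  imports Complex_Main "HOL-Library.Cardinality" "HOL-Number_Theory.Number_Theory"
begin

definition primitive_element :: "'a::{field,finite} \<Rightarrow> bool" where
  "primitive_element \<alpha> \<longleftrightarrow> range (\<lambda>n::nat. \<alpha> ^ n) = UNIV - {0}"

text \<open>The trace from the field with \<open>q ^ 3\<close> elements to its subfield with \<open>q\<close> elements;
  its values are kept in the big field.\<close>

definition trace3 :: "nat \<Rightarrow> 'a::field \<Rightarrow> 'a" where
  "trace3 q x = x + x ^ q + x ^ (q ^ 2)"

text \<open>The discrete logarithm is made unique by taking the least exponent; the lemma
  \<open>chi4_power\<close> below shows that the choice is immaterial.\<close>

definition chi4 :: "'a::{field,finite} \<Rightarrow> 'a \<Rightarrow> complex" where
  "chi4 \<alpha> x = (if x = 0 then 0 else \<i> ^ (LEAST n::nat. x = \<alpha> ^ n))"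

definition chi2 :: "'a::{field,finite} \<Rightarrow> 'a \<Rightarrow> complex" where
  "chi2 \<alpha> x = (chi4 \<alpha> x) ^ 2"

definition kappa :: "nat \<Rightarrow> 'a::{field,finite} \<Rightarrow> complex \<Rightarrow> 'a \<Rightarrow> nat" where
  "kappa q \<alpha> z x =
     (let \<mu> = \<alpha> ^ (q - 1) in
      card {i. i < q ^ 2 + q + 1 \<and>
        chi4 \<alpha> (trace3 q (\<mu> ^ i * x)) * cnj (chi4 \<alpha> (trace3 q (inverse \<mu> ^ i * x))) = z})"

lemma primitive_element_nonzero: "primitive_element \<alpha> \<Longrightarrow> \<alpha> \<noteq> 0"
  unfolding primitive_element_def by (metis DiffE power_one_right rangeI singletonI)

lemma primitive_element_power_eq_1:
  fixes \<alpha> :: "'a::{field,finite}"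
  assumes "primitive_element \<alpha>" and "\<alpha> ^ d = 1"
  shows "(CARD('a) - 1) dvd d"
proof (cases "d = 0")
  case False
  define e where "e = (LEAST n. n > 0 \<and> \<alpha> ^ n = 1)"
  have e: "e > 0 \<and> \<alpha> ^ e = 1"
    unfolding e_def by (rule LeastI[of _ d]) (use False assms in auto)
  have min: "n = 0" if "n < e" "\<alpha> ^ n = 1" for n
    using not_less_Least[of n "\<lambda>n. n > 0 \<and> \<alpha> ^ n = 1"] that by (auto simp: e_def)
  have red: "\<alpha> ^ n = \<alpha> ^ (n mod e)" for n
  proof -
    have "\<alpha> ^ n = \<alpha> ^ (e * (n div e) + n mod e)" by simp
    also have "\<dots> = (\<alpha> ^ e) ^ (n div e) * \<alpha> ^ (n mod e)" by (simp only: power_add power_mult)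
    finally show ?thesis using e by simp
  qed
  have "inj_on (\<lambda>n. \<alpha> ^ n) {..<e}"
  proof (rule linorder_inj_onI')
    fix i j assume ij: "i \<in> {..<e}" "j \<in> {..<e}" "i < j"
    have "\<alpha> ^ j = \<alpha> ^ i * \<alpha> ^ (j - i)"
      using ij by (simp flip: power_add)
    moreover have "\<alpha> ^ (j - i) \<noteq> 1" using min[of "j - i"] ij less_imp_diff_less[of j e i] by auto
    ultimately show "\<alpha> ^ i \<noteq> \<alpha> ^ j"
      using primitive_element_nonzero[OF assms(1)] by auto
  qed
  moreover have "(\<lambda>n. \<alpha> ^ n) ` {..<e} = UNIV - {0}"
  proof -
    have "(\<lambda>n. \<alpha> ^ n) ` {..<e} = range (\<lambda>n. \<alpha> ^ n)"
    proof (intro equalityI subsetI)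
      fix y assume "y \<in> range (\<lambda>n. \<alpha> ^ n)"
      then obtain n where "y = \<alpha> ^ (n mod e)" using red by blast
      then show "y \<in> (\<lambda>n. \<alpha> ^ n) ` {..<e}" using e by auto
    qed auto
    then show ?thesis using assms(1) by (simp add: primitive_element_def)
  qed
  ultimately have "card (UNIV - {0::'a}) = e"
    using card_image[of "\<lambda>n. \<alpha> ^ n" "{..<e}"] by simp
  then have "CARD('a) - 1 = e" by (simp add: card_Diff_singleton)
  moreover have "d mod e = 0"
    using min[of "d mod e"] red[of d] assms(2) e by simp
  ultimately show ?thesis by auto
qed simp

lemma chi4_power:
  fixes \<alpha> :: "'a::{field,finite}"
  assumes "primitive_element \<alpha>" and "[CARD('a) = 1] (mod 4)"
  shows "chi4 \<alpha> (\<alpha> ^ n) = \<i> ^ n"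
proof -
  define m where "m = (LEAST k. \<alpha> ^ n = \<alpha> ^ k)"
  have m: "\<alpha> ^ n = \<alpha> ^ m" unfolding m_def by (rule LeastI) (rule refl)
  have le: "m \<le> n" unfolding m_def by (rule Least_le) (rule refl)
  have nz: "\<alpha> \<noteq> 0" by (rule primitive_element_nonzero[OF assms(1)])
  have "\<alpha> ^ m * \<alpha> ^ (n - m) = \<alpha> ^ m * 1"
    using m le by (simp flip: power_add)
  then have "\<alpha> ^ (n - m) = 1" using nz by simp
  then have "(CARD('a) - 1) dvd (n - m)"
    by (rule primitive_element_power_eq_1[OF assms(1)])
  moreover have "4 dvd CARD('a) - 1"
    using assms(2) by (rule cong_to_1_nat)
  ultimately have "4 dvd n - m" by (rule dvd_trans[rotated])
  then obtain k where k: "n = m + 4 * k" using le by (metis dvdE le_add_diff_inverse)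
  have "\<i> ^ n = \<i> ^ m" unfolding k by (simp add: power_add power_mult)
  then show ?thesis using nz by (simp add: chi4_def m_def)
qed

end

theory Submission
  imports Defs "HOL-Computational_Algebra.Polynomial" "HOL-Analysis.Complex_Transcendental"
begin

text \<open>
  Write \<open>\<eta> = \<chi>\<^sub>2\<close>. Since \<open>gcd (q\<^sup>2 + q + 1) (q - 1) = gcd 3 (q - 1) = 1\<close>, every unit is uniquely
  \<open>c * \<mu> ^ i\<close> with \<open>c\<close> a unit of the field \<open>F\<close> with \<open>q\<close> elements, and
  \<open>\<eta> y * \<chi>\<^sub>4 (T (y * x)) * cnj (\<chi>\<^sub>4 (T (x / y)))\<close> does not change under \<open>y \<mapsto> c * y\<close>. Hence its
  sum over all units \<open>y\<close> is \<open>q - 1\<close> times its sum over the powers of \<open>\<mu>\<close>, and the real part of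
  the latter is \<open>\<kappa>\<^sub>1 - \<kappa>\<^sub>-\<^sub>1\<close>. Expanding both values of \<open>\<chi>\<^sub>4\<close> by Gauss sums over \<open>F\<close> turns it into a
  combination of Salie sums over the big field, which have a closed form. What remains is a constant,
  determined by \<open>\<eta> 2 = \<chi>\<^sub>4 (- 1)\<close> and by \<open>G\<^sup>2 = q\<close> and \<open>G\<^sub>E = q * G\<close> for the quadratic Gauss sums
  \<open>G\<close> of \<open>F\<close> and \<open>G\<^sub>E\<close> of the big field; the last relation holds because \<open>T (y\<^sup>2)\<close> is the quadratic
  form \<open>2 * r * s - t\<^sup>2\<close> over \<open>F\<close> in suitable coordinates.
\<close>

section \<open>Finite fields and their trace maps\<close>

lemma prime_CHAR_finite_field: "prime CHAR('a::{field,finite})"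
  by (intro prime_CHAR_semidom finite_imp_CHAR_pos) simp

lemma finite_field_power_CARD_minus_1:
  fixes x :: "'a::{field,finite}"
  assumes "x \<noteq> 0"
  shows "x ^ (CARD('a) - 1) = 1"
proof -
  have "\<Prod>(UNIV - {0}) = (\<Prod>y\<in>UNIV - {0}. x * y)"
    by (rule prod.reindex_bij_witness[of _ "\<lambda>y. x * y" "\<lambda>y. y / x"]) (use assms in auto)
  also have "\<dots> = x ^ (CARD('a) - 1) * \<Prod>(UNIV - {0})"
    by (simp add: prod.distrib card_Diff_singleton)
  finally show ?thesis by simp
qed

lemma finite_field_power_CARD: "x ^ CARD('a) = (x::'a::{field,finite})"
proof (cases "x = 0")
  case False
  have "x ^ CARD('a) = x * x ^ (CARD('a) - 1)" by (simp flip: power_Suc)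
  then show ?thesis using finite_field_power_CARD_minus_1[OF False] by simp
qed simp

lemma primepow_root_CARD_eq_CHAR_power:
  assumes "primepow q" "CARD('a::{field,finite}) = q ^ m"
  shows "\<exists>n. q = CHAR('a) ^ n"
proof -
  obtain p n where p: "prime p" "q = p ^ n" using assms(1) by (auto simp: primepow_def)
  then have "CHAR('a) dvd p ^ (n * m)"
    using CHAR_dvd_CARD[where 'a='a] assms(2) by (simp add: power_mult)
  then have "CHAR('a) = p"
    using p(1) prime_CHAR_finite_field prime_dvd_power primes_dvd_imp_eq by blast
  then show ?thesis using p(2) by blast
qed

lemma card_power_eq_self_le:
  fixes q :: nat
  assumes "q > 1"
  shows "card {t::'a::field. t ^ q = t} \<le> q"
proof -
  define P :: "'a poly" where "P = monom 1 q - monom 1 1"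
  have "coeff P q = 1" using assms by (simp add: P_def)
  then have "P \<noteq> 0" by auto
  moreover have "degree P \<le> q" unfolding P_def
    using assms by (intro degree_diff_le order.trans[OF degree_monom_le]) auto
  moreover have "{t. poly P t = 0} = {t. t ^ q = t}" by (auto simp: P_def poly_monom)
  ultimately show ?thesis using card_poly_roots_bound[of P] by simp
qed

locale finite_extension =
  fixes q m :: nat and F :: "'a::{field,finite} set"
  assumes F_eq: "F = {t. t ^ q = t}"
    and q_power_CHAR: "\<exists>e. q = CHAR('a) ^ e"
    and card_E: "CARD('a) = q ^ m"
begin

lemma q_gt_1: "q > 1" and m_pos: "m > 0"
proof -
  have "card {0, 1::'a} \<le> CARD('a)" by (rule card_mono) auto
  then have "1 < q ^ m" by (simp add: card_E)
  then show "m > 0" by (cases "m = 0") auto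
  then show "q > 1" using \<open>1 < q ^ m\<close> by (cases "q = 0 \<or> q = 1") (auto simp: power_0_left)
qed

lemma frobenius_add: "(x + y) ^ q = x ^ q + (y ^ q :: 'a)"
  using q_power_CHAR freshmans_dream'[OF prime_CHAR_finite_field] by blast

lemma frobenius_sum: "(\<Sum>i\<in>I. f i) ^ q = (\<Sum>i\<in>I. f i ^ q :: 'a)"
  using q_power_CHAR freshmans_dream_sum'[OF prime_CHAR_finite_field] by blast

lemma frobenius_diff: "(x - y) ^ q = x ^ q - (y ^ q :: 'a)"
  using frobenius_add[of "x - y" y] by simp

definition trace :: "'a \<Rightarrow> 'a" where
  "trace x = (\<Sum>k<m. x ^ q ^ k)"

lemma frobenius_power_add: "(x + y) ^ q ^ k = x ^ q ^ k + (y ^ q ^ k :: 'a)"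
  by (induction k) (simp_all add: power_mult frobenius_add mult.commute[of q])

lemma trace_add: "trace (x + y) = trace x + trace y"
  by (simp add: trace_def frobenius_power_add sum.distrib)

lemma trace_zero [simp]: "trace 0 = 0"
  using trace_add[of 0 0] by (metis add_cancel_right_right)

lemma trace_diff: "trace (x - y) = trace x - trace y"
  using trace_add[of "x - y" y] by simp

lemma trace_in_F [simp]: "trace x \<in> F"
proof -
  have "trace x ^ q + x = (\<Sum>k<m. x ^ q ^ Suc k) + x ^ q ^ 0"
    by (simp add: trace_def frobenius_sum mult.commute flip: power_mult)
  also have "\<dots> = (\<Sum>k<Suc m. x ^ q ^ k)"
    by (simp only: sum.lessThan_Suc_shift add.commute)
  also have "\<dots> = trace x + x ^ CARD('a)"
    by (simp add: trace_def card_E)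
  finally show ?thesis by (simp add: F_eq finite_field_power_CARD)
qed

lemma trace_scale:
  assumes "c \<in> F"
  shows "trace (c * x) = c * trace x"
proof -
  have "c ^ q ^ k = c" for k
    using assms by (induction k) (simp_all add: F_eq power_mult mult.commute[of q])
  then show ?thesis by (simp add: trace_def power_mult_distrib sum_distrib_left)
qed

lemma card_trace_fibre_le: "card {x. trace x = d} \<le> q ^ (m - 1)"
proof -
  define P :: "'a poly" where "P = (\<Sum>k<m. monom 1 (q ^ k)) - monom d 0"
  have "coeff P (q ^ (m - 1)) = (\<Sum>k<m. if k = m - 1 then 1 else 0)"
    using q_gt_1 by (simp add: P_def coeff_sum power_inject_exp)
  then have "coeff P (q ^ (m - 1)) = 1" using m_pos by simp
  then have "P \<noteq> 0" by auto
  moreover have "degree P \<le> q ^ (m - 1)" unfolding P_def using q_gt_1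
    by (intro degree_diff_le degree_sum_le order.trans[OF degree_monom_le])
      (auto intro: power_increasing)
  moreover have "{x. poly P x = 0} = {x. trace x = d}"
    by (auto simp: P_def poly_sum poly_monom trace_def)
  ultimately show ?thesis using card_poly_roots_bound[of P] by simp
qed

lemma card_F: "card F = q"
proof (rule antisym)
  show "card F \<le> q" unfolding F_eq by (rule card_power_eq_self_le[OF q_gt_1])
  have "q * q ^ (m - 1) = CARD('a)"
    using m_pos by (simp add: card_E flip: power_Suc)
  also have "\<dots> = card (\<Union>d\<in>F. {x. trace x = d})"
    by (rule arg_cong[where f = card]) auto
  also have "\<dots> \<le> (\<Sum>d\<in>F. card {x. trace x = d})"
    by (rule card_UN_le) simp
  also have "\<dots> \<le> card F * q ^ (m - 1)"
    using sum_bounded_above[of F "\<lambda>d. card {x. trace x = d}" "q ^ (m - 1)"] card_trace_fibre_le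
    by simp
  finally show "q \<le> card F" using q_gt_1 by simp
qed

lemma trace_surj:
  assumes "d \<in> F"
  obtains z where "trace z = d"
proof -
  have "q ^ (m - 1) < q ^ m" using q_gt_1 m_pos by simp
  then have "{x. trace x = 0} \<noteq> UNIV" using card_trace_fibre_le[of 0]
    by (metis card_E linorder_not_le)
  then obtain z where "trace z \<noteq> 0" by auto
  moreover have "d / trace z \<in> F" using assms trace_in_F[of z] by (simp add: F_eq power_divide)
  then have "trace (d / trace z * z) = d / trace z * trace z" by (rule trace_scale)
  ultimately show ?thesis by (intro that[of "d / trace z * z"]) simp
qed

end

section \<open>Finite subfields and their characters\<close>

locale finite_subfield =
  fixes K :: "'a::field set"
  assumes finite_K [simp]: "finite K"
    and one_closed [simp]: "1 \<in> K"
    and diff_closed [simp]: "a \<in> K \<Longrightarrow> b \<in> K \<Longrightarrow> a - b \<in> K"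
    and mult_closed [simp]: "a \<in> K \<Longrightarrow> b \<in> K \<Longrightarrow> a * b \<in> K"
    and inverse_closed [simp]: "a \<in> K \<Longrightarrow> inverse a \<in> K"
begin

lemma zero_closed [simp]: "0 \<in> K"
  using diff_closed[OF one_closed one_closed] by simp

lemma uminus_closed [simp]: "a \<in> K \<Longrightarrow> - a \<in> K"
  using diff_closed[OF zero_closed] by simp

lemma add_closed [simp]: "a \<in> K \<Longrightarrow> b \<in> K \<Longrightarrow> a + b \<in> K"
  using diff_closed[of a "- b"] by simp

lemma divide_closed [simp]: "a \<in> K \<Longrightarrow> b \<in> K \<Longrightarrow> a / b \<in> K"
  by (simp add: divide_inverse)

lemma power_closed [simp]: "a \<in> K \<Longrightarrow> a ^ n \<in> K"
  by (induction n) simp_all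

lemma numeral_closed [simp]: "numeral n \<in> K"
proof -
  have "of_nat i \<in> K" for i by (induction i) simp_all
  from this[of "numeral n"] show ?thesis by simp
qed

lemma sum_units_eq_sum: "h 0 = 0 \<Longrightarrow> (\<Sum>t\<in>K - {0}. h t) = (\<Sum>t\<in>K. h t)"
  by (simp add: sum.remove[of K 0])

lemma sum_scale: "c \<in> K \<Longrightarrow> c \<noteq> 0 \<Longrightarrow> (\<Sum>t\<in>K. h (c * t)) = (\<Sum>t\<in>K. h t)"
  by (rule sum.reindex_bij_witness[of _ "\<lambda>t. t / c" "\<lambda>t. c * t"]) auto

lemma sum_units_scale: "c \<in> K \<Longrightarrow> c \<noteq> 0 \<Longrightarrow> (\<Sum>t\<in>K - {0}. h (c * t)) = (\<Sum>t\<in>K - {0}. h t)"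
  by (rule sum.reindex_bij_witness[of _ "\<lambda>t. t / c" "\<lambda>t. c * t"]) auto

lemma sum_shift: "c \<in> K \<Longrightarrow> (\<Sum>t\<in>K. h (t + c)) = (\<Sum>t\<in>K. h t)"
  by (rule sum.reindex_bij_witness[of _ "\<lambda>t. t - c" "\<lambda>t. t + c"]) auto

definition nontrivial_multiplicative_character :: "('a \<Rightarrow> complex) \<Rightarrow> bool" where
  "nontrivial_multiplicative_character f \<longleftrightarrow>
     f 0 = 0 \<and> f 1 = 1 \<and> (\<forall>a\<in>K. \<forall>b\<in>K. f (a * b) = f a * f b) \<and> (\<exists>c\<in>K - {0}. f c \<noteq> 1)"

lemma nontrivial_multiplicative_characterD:
  assumes "nontrivial_multiplicative_character f"
  shows "f 0 = 0" "f 1 = 1" "a \<in> K \<Longrightarrow> b \<in> K \<Longrightarrow> f (a * b) = f a * f b"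
  using assms by (auto simp: nontrivial_multiplicative_character_def)

lemma nontrivial_multiplicative_character_inverse:
  assumes "nontrivial_multiplicative_character f"
  shows "nontrivial_multiplicative_character (\<lambda>a. f (inverse a))"
proof -
  obtain c where "c \<in> K - {0}" "f c \<noteq> 1"
    using assms by (auto simp: nontrivial_multiplicative_character_def)
  then have "\<exists>c\<in>K - {0}. f (inverse c) \<noteq> 1" by (intro bexI[of _ "inverse c"]) simp_all
  then show ?thesis using assms by (simp add: nontrivial_multiplicative_character_def)
qed

lemma sum_nontrivial_multiplicative_character:
  assumes "nontrivial_multiplicative_character f"
  shows "(\<Sum>t\<in>K. f t) = 0"
proof -
  obtain c where c: "c \<in> K - {0}" "f c \<noteq> 1"
    using assms by (auto simp: nontrivial_multiplicative_character_def)
  then have "(\<Sum>t\<in>K. f t) = f c * (\<Sum>t\<in>K. f t)"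
    using sum_scale[of c f]
    by (simp add: nontrivial_multiplicative_characterD[OF assms] sum_distrib_left)
  then show ?thesis using c by (metis mult_cancel_right1)
qed

end

lemma finite_subfield_UNIV: "finite_subfield (UNIV :: 'a::{field,finite} set)"
  by unfold_locales simp_all

sublocale finite_extension \<subseteq> F: finite_subfield F
  by unfold_locales
    (use q_gt_1 in \<open>auto simp: F_eq frobenius_diff power_mult_distrib power_inverse\<close>)

locale nontrivial_additive_character = finite_subfield K for K :: "'a::field set" +
  fixes \<psi> :: "'a \<Rightarrow> complex"
  assumes psi_zero [simp]: "\<psi> 0 = 1"
    and psi_add: "a \<in> K \<Longrightarrow> b \<in> K \<Longrightarrow> \<psi> (a + b) = \<psi> a * \<psi> b"
    and psi_nontrivial: "\<exists>c\<in>K. \<psi> c \<noteq> 1"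
begin

lemma sum_psi: "(\<Sum>t\<in>K. \<psi> t) = 0"
proof -
  obtain c where c: "c \<in> K" "\<psi> c \<noteq> 1" using psi_nontrivial by blast
  then have "(\<Sum>t\<in>K. \<psi> t) = (\<Sum>t\<in>K. \<psi> t) * \<psi> c"
    using sum_shift[of c \<psi>] by (simp add: psi_add sum_distrib_right)
  then show ?thesis using c by (metis mult_cancel_left1 mult.commute)
qed

lemma sum_psi_scale:
  assumes "a \<in> K"
  shows "(\<Sum>t\<in>K. \<psi> (a * t)) = (if a = 0 then of_nat (card K) else 0)"
  using sum_scale[OF assms, of \<psi>] by (simp add: sum_psi)

end

lemma prime_field_eq: "{t::'a::{field,finite}. t ^ CHAR('a) = t} = of_nat ` {..<CHAR('a)}"
proof (rule card_seteq[symmetric])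
  have prime: "prime CHAR('a)" by (rule prime_CHAR_finite_field)
  have "of_nat k ^ CHAR('a) = (of_nat k :: 'a)" for k
    using prime by (induction k) (simp_all add: freshmans_dream prime_gt_0_nat)
  then show "of_nat ` {..<CHAR('a)} \<subseteq> {t::'a. t ^ CHAR('a) = t}" by auto
  have "inj_on (of_nat :: nat \<Rightarrow> 'a) {..<CHAR('a)}"
    by (rule inj_onI) (auto simp: of_nat_eq_iff_cong_CHAR cong_def)
  then show "card {t::'a. t ^ CHAR('a) = t} \<le> card (of_nat ` {..<CHAR('a)} :: 'a set)"
    using card_power_eq_self_le[OF prime_gt_1_nat[OF prime]] by (simp add: card_image)
qed simp

lemma exists_nontrivial_additive_character:
  assumes "CARD('a::{field,finite}) = CHAR('a) ^ n"
  shows "\<exists>\<psi>. nontrivial_additive_character (UNIV :: 'a set) \<psi> \<and> \<psi> 1 \<noteq> 1"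
proof -
  define p where "p = CHAR('a)"
  have p: "1 \<le> p" using prime_ge_1_nat[OF prime_CHAR_finite_field] by (simp add: p_def)
  interpret finite_extension p n "{t::'a. t ^ p = t}"
    by unfold_locales (auto simp: p_def assms intro: exI[of _ 1])
  define e where "e k = exp (2 * of_real pi * \<i> * of_nat k / of_nat p)" for k
  have e_eq_iff: "e j = e k \<longleftrightarrow> of_nat j = (of_nat k :: 'a)" for j k
    unfolding e_def complex_root_unity_eq[OF p]
    by (simp add: of_nat_eq_iff_cong_CHAR p_def cong_def)
  have e_add: "e (j + k) = e j * e k" for j k
    by (simp add: e_def distrib_left add_divide_distrib exp_add)
  have "\<exists>k. trace t = of_nat k" for t
    using trace_in_F[of t] unfolding p_def prime_field_eq by auto
  then obtain index where index: "\<And>t. trace t = of_nat (index t)" by metis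
  obtain c where c: "trace c = 1" by (rule trace_surj[of 1]) simp_all
  define \<psi> where "\<psi> t = e (index (c * t))" for t
  have "\<psi> (a + b) = \<psi> a * \<psi> b" for a b
    unfolding \<psi>_def e_add[symmetric] e_eq_iff of_nat_add index[symmetric]
    by (simp add: distrib_left trace_add)
  moreover have "\<psi> 0 = 1"
    using e_eq_iff[of "index 0" 0] index[of 0] by (simp add: \<psi>_def e_def)
  moreover have "\<psi> 1 \<noteq> 1"
    using e_eq_iff[of "index c" 0] index[of c] c by (simp add: \<psi>_def e_def)
  ultimately have "nontrivial_additive_character (UNIV :: 'a set) \<psi>"
    using finite_subfield_UNIV
    by (auto simp: nontrivial_additive_character_def nontrivial_additive_character_axioms_def)
  then show ?thesis using \<open>\<psi> 1 \<noteq> 1\<close> by blast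
qed

context nontrivial_additive_character
begin

definition gauss_sum :: "('a \<Rightarrow> complex) \<Rightarrow> complex" where
  "gauss_sum f = (\<Sum>t\<in>K. f t * \<psi> t)"

lemma gauss_sum_twist:
  assumes f: "nontrivial_multiplicative_character f" and t: "t \<in> K"
  shows "(\<Sum>s\<in>K. f s * \<psi> (s * t)) = f (inverse t) * gauss_sum f"
proof (cases "t = 0")
  case True
  then show ?thesis
    using sum_nontrivial_multiplicative_character[OF f]
    by (simp add: nontrivial_multiplicative_characterD[OF f])
next
  case False
  have "(\<Sum>s\<in>K. f s * \<psi> (s * t)) = (\<Sum>s\<in>K. f (inverse t * (t * s)) * \<psi> (t * s))"
    using False by (simp add: mult.commute[of _ t] flip: mult.assoc)
  also have "\<dots> = (\<Sum>s\<in>K. f (inverse t * s) * \<psi> s)"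
    by (rule sum_scale[OF t False])
  also have "\<dots> = f (inverse t) * gauss_sum f"
    using t unfolding gauss_sum_def
    by (simp add: nontrivial_multiplicative_characterD[OF f] sum_distrib_left mult.assoc)
  finally show ?thesis .
qed

lemma gauss_sum_mult_gauss_sum_inverse:
  assumes f: "nontrivial_multiplicative_character f"
  shows "gauss_sum f * gauss_sum (\<lambda>a. f (inverse a)) = f (- 1) * of_nat (card K)"
proof -
  have "gauss_sum f * gauss_sum (\<lambda>a. f (inverse a)) = (\<Sum>t\<in>K. \<psi> t * (f (inverse t) * gauss_sum f))"
    unfolding gauss_sum_def[of "\<lambda>a. f (inverse a)"] by (simp add: sum_distrib_left mult_ac)
  also have "\<dots> = (\<Sum>t\<in>K. \<Sum>s\<in>K. f s * \<psi> ((s + 1) * t))"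
  proof (rule sum.cong[OF refl])
    fix t assume t: "t \<in> K"
    show "\<psi> t * (f (inverse t) * gauss_sum f) = (\<Sum>s\<in>K. f s * \<psi> ((s + 1) * t))"
      unfolding gauss_sum_twist[OF f t, symmetric] sum_distrib_left
      by (rule sum.cong) (use t in \<open>simp_all add: psi_add distrib_right\<close>)
  qed
  also have "\<dots> = (\<Sum>s\<in>K. f s * (\<Sum>t\<in>K. \<psi> ((s + 1) * t)))"
    by (subst sum.swap) (simp add: sum_distrib_left)
  also have "\<dots> = (\<Sum>s\<in>K. if s = - 1 then f s * of_nat (card K) else 0)"
    by (simp add: sum_psi_scale eq_neg_iff_add_eq_0 if_distrib cong: if_cong)
  also have "\<dots> = f (- 1) * of_nat (card K)"
    by simp
  finally show ?thesis .
qed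

end

section \<open>Quadratic characters and Salie sums\<close>

locale quadratic_character = finite_subfield K for K :: "'a::field set" +
  fixes \<eta> :: "'a \<Rightarrow> complex"
  assumes two_nonzero: "(2::'a) \<noteq> 0"
    and eta_zero [simp]: "\<eta> 0 = 0"
    and eta_mult: "a \<in> K \<Longrightarrow> b \<in> K \<Longrightarrow> \<eta> (a * b) = \<eta> a * \<eta> b"
    and eta_eq_1_iff: "a \<in> K \<Longrightarrow> \<eta> a = 1 \<longleftrightarrow> a \<noteq> 0 \<and> (\<exists>b\<in>K. b\<^sup>2 = a)"
    and eta_cases: "a \<in> K \<Longrightarrow> a \<noteq> 0 \<Longrightarrow> \<eta> a = 1 \<or> \<eta> a = - 1"
begin

lemma neq_uminus: "a \<noteq> 0 \<Longrightarrow> a \<noteq> - (a::'a)"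
  using two_nonzero by (simp add: eq_neg_iff_add_eq_0 flip: mult_2)

lemma eta_one [simp]: "\<eta> 1 = 1"
  using eta_eq_1_iff[of 1] by (auto intro: bexI[of _ 1])

lemma eta_mult_self: "a \<in> K \<Longrightarrow> a \<noteq> 0 \<Longrightarrow> \<eta> a * \<eta> a = 1"
  using eta_cases[of a] by auto

lemma eta_inverse: "a \<in> K \<Longrightarrow> \<eta> (inverse a) = \<eta> a"
  using eta_mult[of a "inverse a"] eta_cases[of a]
  by (cases "a = 0") (auto simp: minus_equation_iff)

lemma eta_nonsquare:
  assumes "a \<in> K" "\<nexists>b. b \<in> K \<and> b\<^sup>2 = a"
  shows "\<eta> a = - 1"
proof -
  have "a \<noteq> 0" using assms(2) zero_closed by (metis zero_power2)
  then show ?thesis using assms eta_eq_1_iff[of a] eta_cases[of a] by auto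
qed

lemma exists_eta_minus_1: obtains c where "c \<in> K" "c \<noteq> 0" "\<eta> c = - 1"
proof -
  have "1 \<noteq> (- 1 :: 'a)" by (rule neq_uminus) simp
  then have "\<not> inj_on (\<lambda>b. b\<^sup>2) K" using inj_onD[of "\<lambda>b. b\<^sup>2" K 1 "- 1"] by auto
  then have "(\<lambda>b. b\<^sup>2) ` K \<noteq> K" by (metis eq_card_imp_inj_on finite_K)
  then obtain c where "c \<in> K" "\<nexists>b. b \<in> K \<and> b\<^sup>2 = c" by auto
  then show ?thesis using eta_nonsquare[of c] by (intro that[of c]) auto
qed

lemma nontrivial_multiplicative_character_eta: "nontrivial_multiplicative_character \<eta>"
proof -
  obtain c where "c \<in> K" "c \<noteq> 0" "\<eta> c = - 1" by (rule exists_eta_minus_1)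
  then have "\<exists>c\<in>K - {0}. \<eta> c \<noteq> 1" by (intro bexI[of _ c]) auto
  then show ?thesis by (simp add: nontrivial_multiplicative_character_def eta_mult)
qed

lemma card_sqrts:
  assumes "c \<in> K"
  shows "of_nat (card {y \<in> K. y\<^sup>2 = c}) = 1 + \<eta> c"
proof -
  consider (zero) "c = 0" | (square) r where "r \<in> K" "r \<noteq> 0" "r\<^sup>2 = c"
    | (nonsquare) "\<nexists>r. r \<in> K \<and> r\<^sup>2 = c" by fastforce
  then show ?thesis
  proof cases
    case zero
    then have "{y \<in> K. y\<^sup>2 = c} = {0}" by auto
    then show ?thesis using zero by simp
  next
    case square
    then have "{y \<in> K. y\<^sup>2 = c} = {r, - r}" by (auto simp: power2_eq_iff)
    moreover have "\<eta> c = 1" using square assms by (auto simp: eta_eq_1_iff)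
    ultimately show ?thesis using neq_uminus[OF \<open>r \<noteq> 0\<close>] by simp
  next
    case nonsquare
    then have "{y \<in> K. y\<^sup>2 = c} = {}" by auto
    then show ?thesis using eta_nonsquare[OF assms nonsquare] by simp
  qed
qed

lemma sum_over_squares: "(\<Sum>y\<in>K. h (y\<^sup>2)) = (\<Sum>c\<in>K. (1 + \<eta> c) * h c)"
proof -
  have "(\<Sum>y\<in>K. h (y\<^sup>2)) = (\<Sum>c\<in>K. \<Sum>y | y \<in> K \<and> y\<^sup>2 = c. h (y\<^sup>2))"
    by (rule sum.group[symmetric]) auto
  also have "\<dots> = (\<Sum>c\<in>K. (1 + \<eta> c) * h c)"
    by (rule sum.cong) (simp_all add: card_sqrts)
  finally show ?thesis .
qed

lemma sum_over_unit_squares: "(\<Sum>y\<in>K - {0}. h (y\<^sup>2)) = (\<Sum>c\<in>K - {0}. (1 + \<eta> c) * h c)"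
  using sum_over_squares[of h] by (simp add: sum.remove[of K 0])

lemma card_add_inverse_fibre:
  assumes t: "t \<in> K"
  shows "of_nat (card {z \<in> K - {0}. z + inverse z = t}) = 1 + \<eta> (t\<^sup>2 - 4)"
proof -
  have complete_square: "z \<noteq> 0 \<and> z + inverse z = t \<longleftrightarrow> (2 * z - t)\<^sup>2 = t\<^sup>2 - 4" for z
  proof -
    have "z \<noteq> 0 \<and> z + inverse z = t \<longleftrightarrow> z * (t - z) = 1"
      by (metis add_diff_cancel_left' diff_add_cancel add.commute inverse_unique mult_zero_left
          right_inverse zero_neq_one)
    also have "\<dots> \<longleftrightarrow> 2 * 2 * (z * (t - z) - 1) = 0"
      using two_nonzero by (metis mult_eq_0_iff eq_iff_diff_eq_0)
    also have "2 * 2 * (z * (t - z) - 1) = t\<^sup>2 - 4 - (2 * z - t)\<^sup>2"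
      by (simp add: power2_eq_square algebra_simps)
    finally show ?thesis by (metis eq_iff_diff_eq_0)
  qed
  then have "{z \<in> K - {0}. z + inverse z = t} = {z \<in> K. (2 * z - t)\<^sup>2 = t\<^sup>2 - 4}" by blast
  moreover have "bij_betw (\<lambda>z. 2 * z - t) {z \<in> K. (2 * z - t)\<^sup>2 = t\<^sup>2 - 4} {d \<in> K. d\<^sup>2 = t\<^sup>2 - 4}"
    by (rule bij_betw_byWitness[of _ "\<lambda>d. d / 2 + t / 2"])
      (use t two_nonzero in \<open>auto simp: diff_divide_distrib\<close>)
  ultimately show ?thesis using t by (simp add: bij_betw_same_card flip: card_sqrts)
qed

lemma sum_over_add_inverse:
  "(\<Sum>z\<in>K - {0}. h (z + inverse z)) = (\<Sum>t\<in>K. (1 + \<eta> (t\<^sup>2 - 4)) * h t)"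
proof -
  have "(\<Sum>z\<in>K - {0}. h (z + inverse z))
      = (\<Sum>t\<in>K. \<Sum>z | z \<in> K - {0} \<and> z + inverse z = t. h (z + inverse z))"
    by (rule sum.group[symmetric]) auto
  also have "\<dots> = (\<Sum>t\<in>K. (1 + \<eta> (t\<^sup>2 - 4)) * h t)"
  proof (rule sum.cong[OF refl])
    fix t assume t: "t \<in> K"
    show "(\<Sum>z | z \<in> K - {0} \<and> z + inverse z = t. h (z + inverse z)) = (1 + \<eta> (t\<^sup>2 - 4)) * h t"
      by (simp flip: card_add_inverse_fibre[OF t])
  qed
  finally show ?thesis .
qed

text \<open>Writing \<open>\<eta> z\<close> as the number of square roots \<open>w\<close> of \<open>z\<close> minus 1 reduces this to the previous
  lemma, because \<open>w\<^sup>2 + 1/w\<^sup>2 = (w + 1/w)\<^sup>2 - 2\<close>.\<close>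

lemma sum_eta_over_add_inverse:
  "(\<Sum>z\<in>K - {0}. \<eta> z * h (z + inverse z)) = (\<Sum>t\<in>K. (\<eta> (t + 2) + \<eta> (t - 2)) * h t)"
proof -
  have "(\<Sum>z\<in>K - {0}. h (z + inverse z)) + (\<Sum>z\<in>K - {0}. \<eta> z * h (z + inverse z))
      = (\<Sum>w\<in>K - {0}. h (w\<^sup>2 + inverse (w\<^sup>2)))"
    unfolding sum_over_unit_squares[of "\<lambda>z. h (z + inverse z)"]
    by (simp add: distrib_right sum.distrib)
  also have "\<dots> = (\<Sum>w\<in>K - {0}. h ((w + inverse w)\<^sup>2 - 2))"
  proof (rule sum.cong[OF refl])
    fix w :: 'a assume "w \<in> K - {0}"
    then have "(w + inverse w)\<^sup>2 - 2 = w\<^sup>2 + inverse (w\<^sup>2)" by (simp add: power2_sum power_inverse)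
    then show "h (w\<^sup>2 + inverse (w\<^sup>2)) = h ((w + inverse w)\<^sup>2 - 2)" by simp
  qed
  also have "\<dots> = (\<Sum>t\<in>K. (1 + \<eta> (t\<^sup>2 - 4)) * h (t\<^sup>2 - 2))"
    by (rule sum_over_add_inverse)
  also have "\<dots> = (\<Sum>c\<in>K. (1 + \<eta> c) * ((1 + \<eta> (c - 4)) * h (c - 2)))"
    by (rule sum_over_squares)
  also have "\<dots> = (\<Sum>t\<in>K. (1 + \<eta> (t + 2)) * ((1 + \<eta> (t - 2)) * h t))"
    using sum_shift[of 2 "\<lambda>c. (1 + \<eta> c) * ((1 + \<eta> (c - 4)) * h (c - 2))"] by simp
  also have "\<dots> = (\<Sum>t\<in>K. (1 + \<eta> (t\<^sup>2 - 4)) * h t + (\<eta> (t + 2) + \<eta> (t - 2)) * h t)"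
  proof (rule sum.cong[OF refl])
    fix t assume "t \<in> K"
    then have "\<eta> (t\<^sup>2 - 4) = \<eta> (t + 2) * \<eta> (t - 2)"
      by (simp add: power2_eq_square algebra_simps flip: eta_mult)
    then show "(1 + \<eta> (t + 2)) * ((1 + \<eta> (t - 2)) * h t)
        = (1 + \<eta> (t\<^sup>2 - 4)) * h t + (\<eta> (t + 2) + \<eta> (t - 2)) * h t"
      by (simp add: algebra_simps)
  qed
  also have "\<dots> = (\<Sum>z\<in>K - {0}. h (z + inverse z)) + (\<Sum>t\<in>K. (\<eta> (t + 2) + \<eta> (t - 2)) * h t)"
    unfolding sum_over_add_inverse by (rule sum.distrib)
  finally show ?thesis by simp
qed

end

locale quadratic_gauss_sum = quadratic_character K \<eta> + nontrivial_additive_character K \<psi>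
  for K :: "'a::field set" and \<eta> \<psi> :: "'a \<Rightarrow> complex"
begin

lemma gauss_sum_eta_twist: "a \<in> K \<Longrightarrow> (\<Sum>t\<in>K. \<eta> t * \<psi> (a * t)) = \<eta> a * gauss_sum \<eta>"
  using gauss_sum_twist[OF nontrivial_multiplicative_character_eta, of a]
  by (simp add: eta_inverse mult.commute[of a])

lemma sum_psi_square:
  assumes "a \<in> K" "a \<noteq> 0"
  shows "(\<Sum>t\<in>K. \<psi> (a * t\<^sup>2)) = \<eta> a * gauss_sum \<eta>"
proof -
  have "(\<Sum>t\<in>K. \<psi> (a * t\<^sup>2)) = (\<Sum>c\<in>K. (1 + \<eta> c) * \<psi> (a * c))"
    by (rule sum_over_squares)
  also have "\<dots> = (\<Sum>c\<in>K. \<psi> (a * c)) + (\<Sum>c\<in>K. \<eta> c * \<psi> (a * c))"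
    by (simp add: distrib_right sum.distrib)
  also have "\<dots> = \<eta> a * gauss_sum \<eta>"
    using assms by (simp add: sum_psi_scale gauss_sum_eta_twist)
  finally show ?thesis .
qed

lemma gauss_sum_eta_mult_self: "gauss_sum \<eta> * gauss_sum \<eta> = \<eta> (- 1) * of_nat (card K)"
proof -
  have "gauss_sum (\<lambda>a. \<eta> (inverse a)) = gauss_sum \<eta>"
    by (simp add: gauss_sum_def eta_inverse)
  then show ?thesis
    using gauss_sum_mult_gauss_sum_inverse[OF nontrivial_multiplicative_character_eta] by simp
qed

definition salie_sum :: "'a \<Rightarrow> 'a \<Rightarrow> complex" where
  "salie_sum a b = (\<Sum>y\<in>K - {0}. \<eta> y * \<psi> (a * y + b * inverse y))"

lemma salie_sum_commute: "salie_sum a b = salie_sum b a"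
  unfolding salie_sum_def
  by (rule sum.reindex_bij_witness[of _ inverse inverse]) (auto simp: eta_inverse add.commute)

lemma salie_sum_scale:
  assumes s: "s \<in> K" "s \<noteq> 0"
  shows "salie_sum (s * a) b = \<eta> s * salie_sum a (s * b)"
proof -
  have "salie_sum (s * a) b
      = (\<Sum>y\<in>K - {0}. \<eta> s * (\<eta> (s * y) * \<psi> (a * (s * y) + s * b * inverse (s * y))))"
    unfolding salie_sum_def
  proof (rule sum.cong[OF refl])
    fix y assume y: "y \<in> K - {0}"
    have "\<eta> s * \<eta> (s * y) = \<eta> y"
      using s y eta_mult_self[OF s] by (simp add: eta_mult flip: mult.assoc)
    moreover have "a * (s * y) = s * a * y" "s * b * inverse (s * y) = b * inverse y"
      using s by simp_all
    ultimately show "\<eta> y * \<psi> (s * a * y + b * inverse y)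
        = \<eta> s * (\<eta> (s * y) * \<psi> (a * (s * y) + s * b * inverse (s * y)))"
      by (simp only: mult.assoc[symmetric])
  qed
  also have "\<dots> = (\<Sum>y\<in>K - {0}. \<eta> s * (\<eta> y * \<psi> (a * y + s * b * inverse y)))"
    by (rule sum_units_scale[OF s])
  also have "\<dots> = \<eta> s * salie_sum a (s * b)"
    by (simp add: salie_sum_def sum_distrib_left)
  finally show ?thesis .
qed

lemma gauss_sum_eta_shift_twist:
  assumes c: "c \<in> K" and e: "e \<in> K"
  shows "(\<Sum>t\<in>K. \<eta> (t + e) * \<psi> (c * t)) = \<eta> c * gauss_sum \<eta> * \<psi> (- (c * e))"
proof -
  have "(\<Sum>t\<in>K. \<eta> (t + e) * \<psi> (c * t)) = (\<Sum>t\<in>K. \<eta> t * \<psi> (c * (t - e)))"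
    using sum_shift[OF e, of "\<lambda>t. \<eta> t * \<psi> (c * (t - e))"] by simp
  also have "\<dots> = (\<Sum>t\<in>K. \<eta> t * \<psi> (c * t)) * \<psi> (- (c * e))"
    unfolding sum_distrib_right
  proof (rule sum.cong[OF refl])
    fix t assume "t \<in> K"
    moreover have "c * (t - e) = c * t + - (c * e)" by (simp add: right_diff_distrib)
    ultimately show "\<eta> t * \<psi> (c * (t - e)) = \<eta> t * \<psi> (c * t) * \<psi> (- (c * e))"
      using c e by (simp only: psi_add mult_closed uminus_closed mult.assoc)
  qed
  finally show ?thesis by (simp add: gauss_sum_eta_twist[OF c])
qed

lemma salie_sum_diagonal:
  assumes c: "c \<in> K"
  shows "salie_sum c c = \<eta> c * gauss_sum \<eta> * (\<psi> (2 * c) + \<psi> (- (2 * c)))"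
proof -
  have "salie_sum c c = (\<Sum>y\<in>K - {0}. \<eta> y * \<psi> (c * (y + inverse y)))"
    by (simp add: salie_sum_def distrib_left)
  also have "\<dots> = (\<Sum>t\<in>K. (\<eta> (t + 2) + \<eta> (t - 2)) * \<psi> (c * t))"
    by (rule sum_eta_over_add_inverse)
  also have "\<dots> = (\<Sum>t\<in>K. \<eta> (t + 2) * \<psi> (c * t)) + (\<Sum>t\<in>K. \<eta> (t + - 2) * \<psi> (c * t))"
    by (simp add: distrib_right sum.distrib)
  also have "\<dots> = \<eta> c * gauss_sum \<eta> * \<psi> (- (c * 2)) + \<eta> c * gauss_sum \<eta> * \<psi> (- (c * - 2))"
    unfolding gauss_sum_eta_shift_twist[OF c numeral_closed]
      gauss_sum_eta_shift_twist[OF c uminus_closed[OF numeral_closed]] ..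
  finally show ?thesis by (simp add: distrib_left mult.commute add.commute)
qed

lemma salie_sum_1_square:
  assumes c: "c \<in> K" "c \<noteq> 0"
  shows "salie_sum 1 (c\<^sup>2) = gauss_sum \<eta> * (\<psi> (2 * c) + \<psi> (- (2 * c)))"
proof -
  have "salie_sum 1 (c\<^sup>2) = \<eta> c * (\<eta> c * salie_sum 1 (c * c))"
    using eta_mult_self[OF c] by (simp add: power2_eq_square flip: mult.assoc)
  also have "\<dots> = \<eta> c * salie_sum c c"
    using salie_sum_scale[OF c, of 1 c] by simp
  also have "\<dots> = gauss_sum \<eta> * (\<psi> (2 * c) + \<psi> (- (2 * c)))"
    unfolding salie_sum_diagonal[OF c(1)] using eta_mult_self[OF c] by (simp flip: mult.assoc)
  finally show ?thesis .
qed

theorem salie_sum_eq: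
  assumes a: "a \<in> K" "a \<noteq> 0" and b: "b \<in> K" "b \<noteq> 0"
  shows "salie_sum a b = \<eta> a * gauss_sum \<eta> * (\<Sum>c | c \<in> K \<and> c\<^sup>2 = a * b. \<psi> (2 * c))"
proof -
  have salie: "salie_sum a b = \<eta> a * salie_sum 1 (a * b)"
    using salie_sum_scale[OF a, of 1 b] by simp
  show ?thesis
  proof (cases "\<exists>c\<in>K. c\<^sup>2 = a * b")
    case True
    then obtain c where c: "c \<in> K" "c\<^sup>2 = a * b" by blast
    then have "c \<noteq> 0" using a b by auto
    have "{d. d \<in> K \<and> d\<^sup>2 = a * b} = {c, - c}"
      using c(1) unfolding c(2)[symmetric] by (auto simp: power2_eq_iff)
    then show ?thesis
      using neq_uminus[OF \<open>c \<noteq> 0\<close>] salie_sum_1_square[OF c(1) \<open>c \<noteq> 0\<close>] by (simp add: salie c(2))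
  next
    case False
    then have "\<eta> a * \<eta> b = - 1" using eta_nonsquare[of "a * b"] a b by (auto simp: eta_mult)
    then have "\<eta> b = - \<eta> a" using eta_cases[OF a] by (auto simp: minus_equation_iff)
    then have "salie_sum b a = - salie_sum a b"
      using salie_sum_scale[OF b, of 1 a] by (simp add: salie mult.commute)
    then have "salie_sum a b = 0" by (simp add: salie_sum_commute[of b])
    moreover have "{c. c \<in> K \<and> c\<^sup>2 = a * b} = {}" using False by auto
    ultimately show ?thesis by (simp only: sum.empty mult_zero_right)
  qed
qed

end

section \<open>Quadratic Gauss sums in cubic extensions\<close>

locale cubic_extension_character = finite_extension q 3 F +
  E: quadratic_character UNIV \<eta> + F: nontrivial_additive_character F \<psi>
  for q :: nat and F :: "'a::{field,finite} set" and \<eta> \<psi> :: "'a \<Rightarrow> complex"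
begin

abbreviation \<Psi> :: "'a \<Rightarrow> complex" where
  "\<Psi> y \<equiv> \<psi> (trace y)"

lemma trace_eq: "trace x = x + x ^ q + (x ^ q) ^ q"
  unfolding trace_def by (simp add: numeral_3_eq_3 power_mult)

lemma frobenius_cube: "((x ^ q) ^ q) ^ q = (x::'a)"
  using finite_field_power_CARD[of x] by (simp add: card_E power3_eq_cube power_mult)

lemma frobenius_uminus: "(- x) ^ q = - (x ^ q :: 'a)"
  using frobenius_diff[of 0 x] q_gt_1 by simp

lemma square_root_in_F:
  assumes "r\<^sup>2 \<in> F"
  shows "r \<in> F"
proof -
  have "(r ^ q)\<^sup>2 = r\<^sup>2" using assms by (simp add: F_eq mult.commute flip: power_mult)
  then consider (fixed) "r ^ q = r" | (negated) "r ^ q = - r" by (auto simp: power2_eq_iff)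
  then show ?thesis
  proof cases
    case fixed
    then show ?thesis by (simp add: F_eq)
  next
    case negated
    then have "r = - r" using frobenius_cube[of r] by (simp add: frobenius_uminus)
    then have "r = 0" using E.neq_uminus by blast
    then show ?thesis by simp
  qed
qed

sublocale E: quadratic_gauss_sum UNIV \<eta> \<Psi>
proof unfold_locales
  obtain c where "c \<in> F" "\<psi> c \<noteq> 1" using F.psi_nontrivial by blast
  moreover obtain z where "trace z = c" by (rule trace_surj[OF \<open>c \<in> F\<close>])
  ultimately show "\<exists>z\<in>UNIV. \<Psi> z \<noteq> 1" by auto
qed (simp_all add: trace_add F.psi_add)

sublocale F: quadratic_gauss_sum F \<eta> \<psi>
proof unfold_locales
  show "\<eta> a = 1 \<longleftrightarrow> a \<noteq> 0 \<and> (\<exists>b\<in>F. b\<^sup>2 = a)" if "a \<in> F" for a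
    using that E.eta_eq_1_iff[of a] square_root_in_F by blast
qed (use E.two_nonzero E.eta_cases in \<open>auto simp: E.eta_mult\<close>)

text \<open>Every nonzero element of the kernel of the trace has a multiple by a unit of \<open>F\<close> that is a
  square.\<close>

lemma exists_isotropic_vector: obtains v where "v \<noteq> 0" "trace (v\<^sup>2) = 0"
proof -
  have "\<not> inj trace"
  proof
    assume "inj trace"
    then have "CARD('a) \<le> card F" by (rule card_inj_on_le) auto
    moreover have "q ^ 1 < q ^ 3" by (rule power_strict_increasing) (use q_gt_1 in auto)
    ultimately show False by (simp add: card_E card_F)
  qed
  then obtain a b where "a \<noteq> b" "trace a = trace b" by (auto simp: inj_def)
  moreover define z where "z = a - b"
  ultimately have z: "trace z = 0" "z \<noteq> 0" by (simp_all add: trace_diff)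
  obtain c where c: "c \<in> F" "c \<noteq> 0" "\<eta> c = - 1" by (rule F.exists_eta_minus_1)
  have "\<exists>d\<in>F. d \<noteq> 0 \<and> \<eta> (d * z) = 1"
  proof (cases "\<eta> z = 1")
    case False
    then have "\<eta> (c * z) = 1" using E.eta_cases[of z] z(2) c(3) by (simp add: E.eta_mult)
    then show ?thesis using c by blast
  qed (auto intro: bexI[of _ 1])
  then obtain d v where "d \<in> F" "d * z \<noteq> 0" "v\<^sup>2 = d * z"
    using E.eta_eq_1_iff by (auto simp del: mult_eq_0_iff)
  then show ?thesis using z(1) by (intro that[of v]) (auto simp: trace_scale)
qed

text \<open>The vector \<open>u\<close> is the cross product of \<open>v\<close> and \<open>w\<close> in the coordinates \<open>y, y ^ q, (y ^ q) ^ q\<close>,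
  in which \<open>trace (x * y)\<close> is the dot product; \<open>trace (u\<^sup>2)\<close> is then given by Lagrange's identity.\<close>

lemma exists_trace_form_basis:
  obtains u v w where "trace (u\<^sup>2) = - 1" "trace (v\<^sup>2) = 0" "trace (w\<^sup>2) = 0"
    "trace (v * w) = 1" "trace (u * v) = 0" "trace (u * w) = 0"
proof -
  obtain v where v: "v \<noteq> 0" "trace (v\<^sup>2) = 0" by (rule exists_isotropic_vector)
  obtain z where "trace z = 1" by (rule trace_surj[of 1]) simp_all
  then have vz: "trace (v * (z / v)) = 1" using v(1) by simp
  define c where "c = trace ((z / v)\<^sup>2) / 2"
  have c: "c \<in> F" "trace ((z / v)\<^sup>2) = 2 * c" using E.two_nonzero by (simp_all add: c_def)
  define w where "w = z / v - c * v"
  have "v * w = v * (z / v) - c * v\<^sup>2" by (simp add: w_def power2_eq_square algebra_simps)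
  then have vw: "trace (v * w) = 1"
    using vz v(2) by (simp only: trace_diff trace_scale[OF c(1)]) simp
  have "w\<^sup>2 = (z / v)\<^sup>2 - (2 * c) * (v * (z / v)) + c\<^sup>2 * v\<^sup>2"
    by (simp add: w_def power2_eq_square algebra_simps)
  then have ww: "trace (w\<^sup>2) = 0"
    using c vz v(2)
    by (simp only: trace_diff trace_add trace_scale F.mult_closed F.power_closed F.numeral_closed)
      simp
  define v' v'' w' w'' where "v' = v ^ q" and "v'' = v' ^ q" and "w' = w ^ q" and "w'' = w' ^ q"
  define u where "u = v' * w'' - v'' * w'"
  have u_conjugates: "u ^ q = v'' * w - v * w''" "(v'' * w - v * w'') ^ q = v * w' - v' * w"
    using frobenius_cube[of v] frobenius_cube[of w]
    by (simp_all add: u_def v'_def v''_def w'_def w''_def frobenius_diff power_mult_distrib)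
  have trace_mult: "trace (x * y) = x * y + x ^ q * y ^ q + (x ^ q) ^ q * (y ^ q) ^ q" for x y
    by (simp add: trace_eq power_mult_distrib)
  note conjugates = v'_def[symmetric] v''_def[symmetric] w'_def[symmetric] w''_def[symmetric]
  have "trace (u * v) = 0" "trace (u * w) = 0"
    unfolding trace_mult u_conjugates conjugates by (simp_all add: u_def algebra_simps)
  moreover have "trace (u * u) = trace (v * v) * trace (w * w) - trace (v * w) * trace (v * w)"
    unfolding trace_mult u_conjugates conjugates by (simp add: u_def algebra_simps)
  then have "trace (u\<^sup>2) = - 1" using v(2) ww vw by (simp add: power2_eq_square)
  ultimately show ?thesis using that[of u v w] v(2) ww vw by simp
qed

lemma exists_trace_form_coordinates:
  "\<exists>\<phi>. bij_betw \<phi> (F \<times> F \<times> F) UNIV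
     \<and> (\<forall>r\<in>F. \<forall>s\<in>F. \<forall>t\<in>F. trace ((\<phi> (r, s, t))\<^sup>2) = 2 * r * s - t\<^sup>2)"
proof -
  obtain u v w where uvw: "trace (u\<^sup>2) = - 1" "trace (v\<^sup>2) = 0" "trace (w\<^sup>2) = 0"
    "trace (v * w) = 1" "trace (u * v) = 0" "trace (u * w) = 0"
    by (rule exists_trace_form_basis)
  define \<phi> where "\<phi> = (\<lambda>(r, s, t). r * v + s * w + t * u)"
  have trace_lin: "trace (r * x + s * y + t * z) = r * trace x + s * trace y + t * trace z"
    if "r \<in> F" "s \<in> F" "t \<in> F" for r s t x y z
    using that by (simp add: trace_add trace_scale)
  have coordinates: "trace (v * \<phi> (r, s, t)) = s" "trace (w * \<phi> (r, s, t)) = r"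
    "trace (u * \<phi> (r, s, t)) = - t"
    if "r \<in> F" "s \<in> F" "t \<in> F" for r s t
  proof -
    have "x * \<phi> (r, s, t) = r * (v * x) + s * (w * x) + t * (u * x)" for x
      by (simp add: \<phi>_def algebra_simps)
    then have "trace (x * \<phi> (r, s, t)) = r * trace (v * x) + s * trace (w * x) + t * trace (u * x)"
      for x
      by (simp only: trace_lin[OF that])
    then show "trace (v * \<phi> (r, s, t)) = s" "trace (w * \<phi> (r, s, t)) = r"
      "trace (u * \<phi> (r, s, t)) = - t"
      using uvw by (simp_all add: power2_eq_square mult.commute)
  qed
  have inj: "inj_on \<phi> (F \<times> F \<times> F)"
    by (rule inj_on_inverseI[of _ "\<lambda>y. (trace (w * y), trace (v * y), - trace (u * y))"])
      (auto simp: coordinates)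
  have "card (\<phi> ` (F \<times> F \<times> F)) = CARD('a)"
    using card_image[OF inj] by (simp add: card_cartesian_product card_F card_E power3_eq_cube)
  then have "\<phi> ` (F \<times> F \<times> F) = UNIV" by (metis card_subset_eq finite subset_UNIV)
  moreover have "trace ((\<phi> (r, s, t))\<^sup>2) = 2 * r * s - t\<^sup>2" if "r \<in> F" "s \<in> F" "t \<in> F" for r s t
  proof -
    have "(\<phi> (r, s, t))\<^sup>2 = r * (v * \<phi> (r, s, t)) + s * (w * \<phi> (r, s, t)) + t * (u * \<phi> (r, s, t))"
      by (simp add: \<phi>_def power2_eq_square algebra_simps)
    then have "trace ((\<phi> (r, s, t))\<^sup>2) = r * s + s * r + t * - t"
      by (simp only: trace_lin[OF that] coordinates[OF that])
    then show ?thesis by (simp add: power2_eq_square mult.commute[of s])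
  qed
  ultimately show ?thesis using inj by (intro exI[of _ \<phi>]) (auto simp: bij_betw_def)
qed

theorem gauss_sum_cubic_extension: "E.gauss_sum \<eta> = \<eta> (- 1) * of_nat q * F.gauss_sum \<eta>"
proof -
  obtain \<phi> where \<phi>: "bij_betw \<phi> (F \<times> F \<times> F) UNIV"
    "\<forall>r\<in>F. \<forall>s\<in>F. \<forall>t\<in>F. trace ((\<phi> (r, s, t))\<^sup>2) = 2 * r * s - t\<^sup>2"
    using exists_trace_form_coordinates by blast
  have "E.gauss_sum \<eta> = (\<Sum>y\<in>UNIV. \<Psi> (y\<^sup>2))"
    using E.sum_psi_square[of 1] by simp
  also have "\<dots> = (\<Sum>v\<in>F \<times> F \<times> F. \<Psi> ((\<phi> v)\<^sup>2))"
    by (rule sum.reindex_bij_betw[OF \<phi>(1), symmetric])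
  also have "\<dots> = (\<Sum>(r, s, t)\<in>F \<times> F \<times> F. \<psi> (2 * r * s) * \<psi> (- 1 * t\<^sup>2))"
  proof (rule sum.cong[OF refl])
    fix v assume "v \<in> F \<times> F \<times> F"
    then obtain r s t where v: "v = (r, s, t)" "r \<in> F" "s \<in> F" "t \<in> F" by blast
    then have "\<psi> (2 * r * s + - 1 * t\<^sup>2) = \<psi> (2 * r * s) * \<psi> (- 1 * t\<^sup>2)"
      by (intro F.psi_add) simp_all
    then show "\<Psi> ((\<phi> v)\<^sup>2) = (case v of (r, s, t) \<Rightarrow> \<psi> (2 * r * s) * \<psi> (- 1 * t\<^sup>2))"
      using v by (simp add: \<phi>(2))
  qed
  also have "\<dots> = (\<Sum>r\<in>F. \<Sum>s\<in>F. \<psi> (2 * r * s)) * (\<Sum>t\<in>F. \<psi> (- 1 * t\<^sup>2))"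
    by (simp only: sum.cartesian_product[symmetric] sum_distrib_right) (simp only: sum_distrib_left)
  also have "(\<Sum>r\<in>F. \<Sum>s\<in>F. \<psi> (2 * r * s)) = (\<Sum>r\<in>F. if r = 0 then of_nat q else 0)"
    using E.two_nonzero by (intro sum.cong) (simp_all add: F.sum_psi_scale card_F)
  also have "\<dots> = of_nat q" by simp
  also have "(\<Sum>t\<in>F. \<psi> (- 1 * t\<^sup>2)) = \<eta> (- 1) * F.gauss_sum \<eta>"
    by (rule F.sum_psi_square) simp_all
  finally show ?thesis by (simp add: mult_ac)
qed

end

section \<open>The quartic character of a finite field\<close>

locale quartic_character =
  fixes \<alpha> :: "'a::{field,finite}"
  assumes primitive: "primitive_element \<alpha>"
    and card_mod_4: "[CARD('a) = 1] (mod 4)"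
begin

abbreviation \<chi>\<^sub>4 :: "'a \<Rightarrow> complex" where "\<chi>\<^sub>4 \<equiv> chi4 \<alpha>"
abbreviation \<chi>\<^sub>2 :: "'a \<Rightarrow> complex" where "\<chi>\<^sub>2 \<equiv> chi2 \<alpha>"

lemma alpha_nonzero: "\<alpha> \<noteq> 0"
  using primitive by (rule primitive_element_nonzero)

lemma obtain_log:
  assumes "x \<noteq> 0"
  obtains n where "x = \<alpha> ^ n"
  using assms primitive unfolding primitive_element_def by blast

lemma chi4_alpha_power: "\<chi>\<^sub>4 (\<alpha> ^ n) = \<i> ^ n"
  using primitive card_mod_4 by (rule chi4_power)

lemma chi2_alpha_power: "\<chi>\<^sub>2 (\<alpha> ^ n) = (- 1) ^ n"
  by (simp add: chi2_def chi4_alpha_power mult.commute[of n] flip: power_mult)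

lemma chi4_zero [simp]: "\<chi>\<^sub>4 0 = 0"
  by (simp add: chi4_def)

lemma chi4_one [simp]: "\<chi>\<^sub>4 1 = 1"
  using chi4_alpha_power[of 0] by simp

lemma chi4_mult: "\<chi>\<^sub>4 (x * y) = \<chi>\<^sub>4 x * \<chi>\<^sub>4 y"
proof (cases "x = 0 \<or> y = 0")
  case False
  then obtain i j where "x = \<alpha> ^ i" "y = \<alpha> ^ j" by (metis obtain_log)
  then show ?thesis by (simp add: chi4_alpha_power flip: power_add)
qed auto

lemma chi4_power2: "\<chi>\<^sub>4 (x\<^sup>2) = \<chi>\<^sub>2 x"
  by (simp add: chi2_def power2_eq_square chi4_mult)

lemma chi4_inverse_mult_chi2:
  assumes "x \<noteq> 0"
  shows "\<chi>\<^sub>4 (inverse x) * \<chi>\<^sub>2 x = \<chi>\<^sub>4 x"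
  using assms by (simp add: chi2_def power2_eq_square flip: chi4_mult mult.assoc)

lemma cnj_chi4: "cnj (\<chi>\<^sub>4 x) = \<chi>\<^sub>4 (inverse x)"
proof (cases "x = 0")
  case False
  then obtain n where n: "x = \<alpha> ^ n" by (rule obtain_log)
  then have "cnj (\<chi>\<^sub>4 x) * \<chi>\<^sub>4 x = 1"
    by (simp add: chi4_alpha_power flip: power_mult_distrib)
  moreover have "\<chi>\<^sub>4 (inverse x) * \<chi>\<^sub>4 x = 1" using False by (simp flip: chi4_mult)
  ultimately show ?thesis by (metis mult_right_cancel mult_zero_right zero_neq_one)
qed simp

lemma chi4_values: "\<chi>\<^sub>4 x \<in> {0, 1, - 1, \<i>, - \<i>}"
proof (cases "x = 0")
  case False
  then obtain n where "x = \<alpha> ^ n" by (rule obtain_log)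
  moreover have "\<i> ^ k \<in> {1, - 1, \<i>, - \<i>}" for k by (induction k) auto
  ultimately show ?thesis by (simp add: chi4_alpha_power)
qed simp

sublocale E: quadratic_character UNIV \<chi>\<^sub>2
proof unfold_locales
  have "odd CARD('a)" using card_mod_4 by (auto simp: cong_def elim!: evenE) presburger
  show "(2::'a) \<noteq> 0"
  proof
    assume "(2::'a) = 0"
    then have "of_nat 2 = (0::'a)" by simp
    then have "CHAR('a) dvd 2" by (simp only: of_nat_eq_0_iff_char_dvd)
    then have "CHAR('a) = 2"
      using prime_CHAR_finite_field[where 'a='a] by (metis primes_dvd_imp_eq two_is_prime_nat)
    then show False using \<open>odd CARD('a)\<close> CHAR_dvd_CARD[where 'a='a] by simp
  qed
  show "\<chi>\<^sub>2 0 = 0" by (simp add: chi2_def)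
  show mult: "\<chi>\<^sub>2 (a * b) = \<chi>\<^sub>2 a * \<chi>\<^sub>2 b" for a b
    by (simp add: chi2_def chi4_mult power_mult_distrib)
  show cases: "\<chi>\<^sub>2 a = 1 \<or> \<chi>\<^sub>2 a = - 1" if "a \<noteq> 0" for a
    by (metis chi2_alpha_power minus_one_power_iff obtain_log that)
  show "\<chi>\<^sub>2 a = 1 \<longleftrightarrow> a \<noteq> 0 \<and> (\<exists>b\<in>UNIV. b\<^sup>2 = a)" for a
  proof (cases "a = 0")
    case False
    then obtain n where n: "a = \<alpha> ^ n" by (rule obtain_log)
    have "\<chi>\<^sub>2 (b\<^sup>2) = 1" if "b \<noteq> 0" for b
      using cases[OF that] by (auto simp: power2_eq_square mult)
    moreover have "\<exists>b. b\<^sup>2 = a" if "\<chi>\<^sub>2 a = 1"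
    proof -
      have "even n"
        using that by (auto simp: n chi2_alpha_power minus_one_power_iff split: if_splits)
      then have "(\<alpha> ^ (n div 2))\<^sup>2 = a" by (simp add: n flip: power_mult)
      then show ?thesis ..
    qed
    ultimately show ?thesis using False by fastforce
  qed (simp add: chi2_def)
qed simp_all

lemma chi2_minus_1 [simp]: "\<chi>\<^sub>2 (- 1) = 1"
  using chi4_power2[of "- 1"] by simp

lemma chi2_two: "\<chi>\<^sub>2 2 = \<chi>\<^sub>4 (- 1)"
proof -
  obtain j :: 'a where j: "j\<^sup>2 = - 1" using chi2_minus_1 E.eta_eq_1_iff[of "- 1"] by auto
  have "(1 + j)\<^sup>2 = 2 * j" by (simp add: power2_sum j)
  moreover have "j \<noteq> 0" using j by auto
  ultimately have "\<chi>\<^sub>2 (2 * j) = 1" using E.eta_eq_1_iff[of "2 * j"] E.two_nonzero by auto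
  then have "\<chi>\<^sub>2 2 * \<chi>\<^sub>2 j = \<chi>\<^sub>2 j * \<chi>\<^sub>2 j"
    using E.eta_mult_self[of j] \<open>j \<noteq> 0\<close> by (simp add: E.eta_mult)
  then have "\<chi>\<^sub>2 2 = \<chi>\<^sub>2 j" using E.eta_cases[of j] \<open>j \<noteq> 0\<close> by auto
  then show ?thesis using chi4_power2[of j] by (simp add: j)
qed

end

section \<open>The sum over the powers of \<open>\<mu>\<close>\<close>

locale cubic_quartic_character = quartic_character \<alpha> +
  cubic_extension_character q F "chi2 \<alpha>" \<psi>
  for \<alpha> :: "'a::{field,finite}" and q :: nat and F :: "'a set" and \<psi> :: "'a \<Rightarrow> complex" +
  assumes q_mod_4: "[q = 1] (mod 4)" and q_mod_3: "\<not> [q = 1] (mod 3)"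
begin

lemma nontrivial_multiplicative_character_chi4: "F.nontrivial_multiplicative_character \<chi>\<^sub>4"
proof -
  obtain c where "c \<in> F" "c \<noteq> 0" "\<chi>\<^sub>2 c = - 1" by (rule F.exists_eta_minus_1)
  then have "\<exists>c\<in>F - {0}. \<chi>\<^sub>4 c \<noteq> 1" by (intro bexI[of _ c]) (auto simp: chi2_def)
  then show ?thesis by (simp add: F.nontrivial_multiplicative_character_def chi4_mult)
qed

definition twisted_term :: "'a \<Rightarrow> 'a \<Rightarrow> complex" where
  "twisted_term x y = \<chi>\<^sub>2 y * \<chi>\<^sub>4 (trace (y * x)) * cnj (\<chi>\<^sub>4 (trace (inverse y * x)))"

lemma twisted_term_scale:
  assumes c: "c \<in> F" "c \<noteq> 0"
  shows "twisted_term x (c * y) = twisted_term x y"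
proof -
  have "trace (c * y * x) = c * trace (y * x)"
    using trace_scale[OF c(1)] by (simp add: mult.assoc)
  moreover have "trace (inverse (c * y) * x) = inverse c * trace (inverse y * x)"
    using trace_scale[OF F.inverse_closed[OF c(1)]] by (simp add: mult.assoc)
  ultimately have "twisted_term x (c * y) = \<chi>\<^sub>2 c * (\<chi>\<^sub>4 c * \<chi>\<^sub>4 c) * twisted_term x y"
    by (simp add: twisted_term_def E.eta_mult chi4_mult cnj_chi4)
  also have "\<chi>\<^sub>2 c * (\<chi>\<^sub>4 c * \<chi>\<^sub>4 c) = 1"
    using E.eta_mult_self[of c] c(2) by (simp add: chi2_def power2_eq_square)
  finally show ?thesis by simp
qed

lemma sum_gauss_twists_eq_salie_sum:
  assumes "s \<in> F" "t \<in> F"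
  shows "(\<Sum>y\<in>UNIV - {0}. \<chi>\<^sub>2 y * (\<psi> (s * trace (y * x)) * \<psi> (t * trace (inverse y * x))))
       = E.salie_sum (s * x) (t * x)"
  unfolding E.salie_sum_def
proof (rule sum.cong[OF refl])
  fix y :: 'a
  have "\<Psi> (s * x * y + t * x * inverse y) = \<psi> (trace (s * (y * x)) + trace (t * (inverse y * x)))"
    by (simp add: trace_add mult_ac)
  then show "\<chi>\<^sub>2 y * (\<psi> (s * trace (y * x)) * \<psi> (t * trace (inverse y * x)))
      = \<chi>\<^sub>2 y * \<Psi> (s * x * y + t * x * inverse y)"
    using assms by (simp add: F.psi_add trace_scale)
qed

lemma sum_twisted_term_eq_sum_salie_sum:
  "F.gauss_sum (\<lambda>a. \<chi>\<^sub>4 (inverse a)) * F.gauss_sum \<chi>\<^sub>4 * (\<Sum>y\<in>UNIV - {0}. twisted_term x y)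
   = of_nat (q - 1) * (\<Sum>u\<in>F - {0}. \<chi>\<^sub>4 u * E.salie_sum x (u * x))"
proof -
  let ?\<chi>' = "\<lambda>a. \<chi>\<^sub>4 (inverse a)"
  note chi4 = nontrivial_multiplicative_character_chi4
  note twist = F.gauss_sum_twist[OF chi4]
    F.gauss_sum_twist[OF F.nontrivial_multiplicative_character_inverse[OF chi4]]
  have "F.gauss_sum ?\<chi>' * F.gauss_sum \<chi>\<^sub>4 * (\<Sum>y\<in>UNIV - {0}. twisted_term x y)
      = (\<Sum>y\<in>UNIV - {0}. \<chi>\<^sub>2 y * ((\<Sum>s\<in>F. ?\<chi>' s * \<psi> (s * trace (y * x)))
          * (\<Sum>t\<in>F. \<chi>\<^sub>4 t * \<psi> (t * trace (inverse y * x)))))"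
    by (simp add: twist twisted_term_def cnj_chi4 sum_distrib_left mult_ac)
  also have "\<dots> = (\<Sum>s\<in>F. \<Sum>t\<in>F. ?\<chi>' s * \<chi>\<^sub>4 t
      * (\<Sum>y\<in>UNIV - {0}. \<chi>\<^sub>2 y * (\<psi> (s * trace (y * x)) * \<psi> (t * trace (inverse y * x)))))"
    unfolding sum_product unfolding sum_distrib_left
    by (subst sum.swap, rule sum.cong[OF refl], subst sum.swap) (simp add: mult_ac)
  also have "\<dots> = (\<Sum>s\<in>F. \<Sum>t\<in>F. ?\<chi>' s * \<chi>\<^sub>4 t * E.salie_sum (s * x) (t * x))"
    by (simp add: sum_gauss_twists_eq_salie_sum)
  also have "\<dots> = (\<Sum>s\<in>F - {0}. \<Sum>t\<in>F - {0}. ?\<chi>' s * \<chi>\<^sub>4 t * E.salie_sum (s * x) (t * x))"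
    by (simp add: F.sum_units_eq_sum)
  also have "\<dots> = (\<Sum>s\<in>F - {0}. \<Sum>u\<in>F - {0}. \<chi>\<^sub>4 u * E.salie_sum x (u * x))"
  proof (rule sum.cong[OF refl])
    fix s assume s: "s \<in> F - {0}"
    have "?\<chi>' s * \<chi>\<^sub>4 t * E.salie_sum (s * x) (t * x)
        = \<chi>\<^sub>4 (s * t) * E.salie_sum x (s * t * x)" for t
      using s E.salie_sum_scale[of s x "t * x"] chi4_inverse_mult_chi2[of s]
      by (simp add: chi4_mult mult_ac)
    then show "(\<Sum>t\<in>F - {0}. ?\<chi>' s * \<chi>\<^sub>4 t * E.salie_sum (s * x) (t * x))
        = (\<Sum>u\<in>F - {0}. \<chi>\<^sub>4 u * E.salie_sum x (u * x))"
      using s F.sum_units_scale[of s "\<lambda>u. \<chi>\<^sub>4 u * E.salie_sum x (u * x)"] by simp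
  qed
  also have "\<dots> = of_nat (q - 1) * (\<Sum>u\<in>F - {0}. \<chi>\<^sub>4 u * E.salie_sum x (u * x))"
    by (simp add: card_F card_Diff_singleton)
  finally show ?thesis .
qed

lemma salie_sum_F_multiple:
  assumes x: "x \<noteq> 0" and u: "u \<in> F - {0}"
  shows "E.salie_sum x (u * x)
       = \<chi>\<^sub>2 x * E.gauss_sum \<chi>\<^sub>2 * (\<Sum>r | r \<in> F - {0} \<and> r\<^sup>2 = u. \<psi> (2 * trace x * r))"
proof -
  have "(\<Sum>c | c \<in> UNIV \<and> c\<^sup>2 = x * (u * x). \<Psi> (2 * c))
      = (\<Sum>r | r \<in> F - {0} \<and> r\<^sup>2 = u. \<psi> (2 * trace x * r))"
  proof (rule sum.reindex_bij_witness[of _ "\<lambda>r. r * x" "\<lambda>c. c / x"])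
    fix c assume "c \<in> {c. c \<in> UNIV \<and> c\<^sup>2 = x * (u * x)}"
    moreover define r where "r = c / x"
    ultimately have c: "c = r * x" and square: "r\<^sup>2 = u" using x by (auto simp: power2_eq_square)
    have r: "r \<in> F" by (rule square_root_in_F, unfold square) (use u in blast)
    then show "c / x \<in> {r. r \<in> F - {0} \<and> r\<^sup>2 = u}" using square u unfolding r_def by fastforce
    show "c / x * x = c" using x by simp
    have "trace (2 * c) = 2 * trace x * r"
      using r trace_scale[of "2 * r" x] by (simp add: c mult_ac)
    then show "\<psi> (2 * trace x * (c / x)) = \<Psi> (2 * c)" by (simp only: r_def)
  qed (use x in \<open>auto simp: power2_eq_square\<close>)
  then show ?thesis using E.salie_sum_eq[of x "u * x"] x u by simp
qed

lemma sum_chi4_salie_sum: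
  assumes x: "x \<noteq> 0"
  shows "(\<Sum>u\<in>F - {0}. \<chi>\<^sub>4 u * E.salie_sum x (u * x))
       = \<chi>\<^sub>2 x * E.gauss_sum \<chi>\<^sub>2 * (\<chi>\<^sub>2 2 * \<chi>\<^sub>2 (trace x) * F.gauss_sum \<chi>\<^sub>2)"
proof -
  have "(\<Sum>u\<in>F - {0}. \<chi>\<^sub>4 u * E.salie_sum x (u * x))
      = (\<Sum>u\<in>F - {0}. \<Sum>r | r \<in> F - {0} \<and> r\<^sup>2 = u.
          \<chi>\<^sub>2 x * E.gauss_sum \<chi>\<^sub>2 * (\<chi>\<^sub>2 r * \<psi> (2 * trace x * r)))"
    by (intro sum.cong refl)
      (auto simp: salie_sum_F_multiple[OF x] sum_distrib_left chi4_power2 mult_ac intro!: sum.cong)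
  also have "\<dots> = (\<Sum>r\<in>F - {0}. \<chi>\<^sub>2 x * E.gauss_sum \<chi>\<^sub>2 * (\<chi>\<^sub>2 r * \<psi> (2 * trace x * r)))"
    by (rule sum.group) auto
  also have "\<dots> = \<chi>\<^sub>2 x * E.gauss_sum \<chi>\<^sub>2 * (\<Sum>r\<in>F. \<chi>\<^sub>2 r * \<psi> (2 * trace x * r))"
    by (simp add: F.sum_units_eq_sum sum_distrib_left)
  also have "(\<Sum>r\<in>F. \<chi>\<^sub>2 r * \<psi> (2 * trace x * r)) = \<chi>\<^sub>2 2 * \<chi>\<^sub>2 (trace x) * F.gauss_sum \<chi>\<^sub>2"
    by (simp add: F.gauss_sum_eta_twist E.eta_mult)
  finally show ?thesis .
qed

lemma sum_twisted_term:
  assumes x: "x \<noteq> 0"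
  shows "(\<Sum>y\<in>UNIV - {0}. twisted_term x y) = of_nat (q - 1) * (of_nat q * \<chi>\<^sub>2 x * \<chi>\<^sub>2 (trace x))"
proof -
  have "\<chi>\<^sub>2 2 * of_nat q * (\<Sum>y\<in>UNIV - {0}. twisted_term x y)
      = of_nat (q - 1) * (\<chi>\<^sub>2 x * E.gauss_sum \<chi>\<^sub>2 * (\<chi>\<^sub>2 2 * \<chi>\<^sub>2 (trace x) * F.gauss_sum \<chi>\<^sub>2))"
    using sum_twisted_term_eq_sum_salie_sum[of x]
      F.gauss_sum_mult_gauss_sum_inverse[OF nontrivial_multiplicative_character_chi4]
    by (simp add: sum_chi4_salie_sum[OF x] chi2_two card_F mult.commute[of "F.gauss_sum \<chi>\<^sub>4"])
  also have "\<dots> = of_nat (q - 1)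
      * (\<chi>\<^sub>2 x * of_nat q * \<chi>\<^sub>2 2 * \<chi>\<^sub>2 (trace x) * (F.gauss_sum \<chi>\<^sub>2 * F.gauss_sum \<chi>\<^sub>2))"
    by (simp add: gauss_sum_cubic_extension)
  also have "\<dots> = \<chi>\<^sub>2 2 * of_nat q * (of_nat (q - 1) * (of_nat q * \<chi>\<^sub>2 x * \<chi>\<^sub>2 (trace x)))"
    by (simp add: F.gauss_sum_eta_mult_self card_F)
  finally have "\<chi>\<^sub>2 2 * of_nat q * (\<Sum>y\<in>UNIV - {0}. twisted_term x y) = \<dots>" .
  moreover have "\<chi>\<^sub>2 2 * of_nat q \<noteq> 0" using E.eta_cases[of 2] E.two_nonzero q_gt_1 by auto
  ultimately show ?thesis by (metis mult_left_cancel)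
qed

abbreviation \<mu> :: 'a where "\<mu> \<equiv> \<alpha> ^ (q - 1)"
definition N :: nat where "N = q ^ 2 + q + 1"

lemma CARD_minus_1: "CARD('a) - 1 = (q - 1) * N"
proof -
  obtain k where "q = k + 1" using q_gt_1 by (metis add.commute less_imp_add_positive)
  then show ?thesis unfolding N_def card_E
    by (simp add: power3_eq_cube power2_eq_square algebra_simps)
qed

lemma coprime_N: "coprime N (q - 1)"
proof -
  obtain k where k: "q = k + 1" using q_gt_1 by (metis add.commute less_imp_add_positive)
  have "q mod 3 \<noteq> 1" using q_mod_3 by (simp add: cong_def)
  then have "\<not> 3 dvd k" unfolding k by presburger
  then have "coprime 3 k" by (intro prime_imp_coprime) auto
  moreover have "gcd k ((k + 3) * k + 3) = gcd k 3" by (rule gcd_add_mult)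
  moreover have "N = (k + 3) * k + 3"
    unfolding N_def by (simp add: k power2_eq_square algebra_simps)
  moreover have "q - 1 = k" by (simp add: k)
  ultimately show ?thesis by (metis coprime_iff_gcd_eq_1 gcd.commute)
qed

lemma mu_power_in_F_imp_dvd:
  assumes "\<mu> ^ i \<in> F"
  shows "N dvd i"
proof -
  have "\<mu> ^ i * (\<mu> ^ i) ^ (q - 1) = \<mu> ^ i"
    using assms q_gt_1 by (simp add: F_eq flip: power_Suc)
  then have "\<alpha> ^ ((q - 1) * (i * (q - 1))) = 1"
    using alpha_nonzero by (simp add: power_mult)
  from primitive_element_power_eq_1[OF primitive this] have "N dvd i * (q - 1)"
    unfolding CARD_minus_1 using q_gt_1 by simp
  then show ?thesis using coprime_N by (simp add: coprime_dvd_mult_left_iff)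
qed

lemma bij_units_times_mu_powers: "bij_betw (\<lambda>(c, i). c * \<mu> ^ i) ((F - {0}) \<times> {..<N}) (UNIV - {0})"
proof -
  let ?A = "(F - {0}) \<times> {..<N}" and ?f = "\<lambda>(c, i). c * \<mu> ^ i"
  have eq_if_le: "i = j"
    if "i \<le> j" "j < N" "c \<in> F - {0}" "d \<in> F - {0}" "c * \<mu> ^ i = d * \<mu> ^ j" for c d i j
  proof -
    have "\<mu> ^ j = \<mu> ^ i * \<mu> ^ (j - i)" using that(1) by (simp flip: power_add)
    then have "c = d * \<mu> ^ (j - i)" using that(5) alpha_nonzero by simp
    then have "\<mu> ^ (j - i) = c / d" using that by simp
    then have "N dvd j - i" using that by (intro mu_power_in_F_imp_dvd) auto
    then show ?thesis using that by (auto dest: dvd_imp_le)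
  qed
  have inj: "inj_on ?f ?A"
  proof (rule inj_onI)
    fix a b assume "a \<in> ?A" "b \<in> ?A" "?f a = ?f b"
    then obtain c i d j where ab: "a = (c, i)" "b = (d, j)"
      and cd: "c \<in> F - {0}" "d \<in> F - {0}" "i < N" "j < N" "c * \<mu> ^ i = d * \<mu> ^ j" by auto
    then have "i = j" using eq_if_le[of i j c d] eq_if_le[of j i d c] by (cases "i \<le> j") auto
    then show "a = b" using ab cd(5) alpha_nonzero by simp
  qed
  have "card (?f ` ?A) = card (UNIV - {0::'a})"
    using card_image[OF inj] CARD_minus_1
    by (simp add: card_cartesian_product card_F card_Diff_singleton)
  moreover have "?f ` ?A \<subseteq> UNIV - {0}" using alpha_nonzero by auto
  ultimately have "?f ` ?A = UNIV - {0}" by (intro card_subset_eq) auto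
  then show ?thesis using inj by (simp add: bij_betw_def)
qed

definition kappa_term :: "'a \<Rightarrow> nat \<Rightarrow> complex" where
  "kappa_term x i = \<chi>\<^sub>4 (trace (\<mu> ^ i * x)) * cnj (\<chi>\<^sub>4 (trace (inverse \<mu> ^ i * x)))"

lemma twisted_term_mu_power: "twisted_term x (\<mu> ^ i) = kappa_term x i"
proof -
  have "even (q - 1)" using cong_to_1_nat[OF q_mod_4] by (rule dvd_trans[rotated]) simp
  then have "\<chi>\<^sub>2 (\<mu> ^ i) = 1" by (simp add: chi2_alpha_power flip: power_mult)
  then show ?thesis by (simp add: twisted_term_def kappa_term_def power_inverse)
qed

lemma kappa_term_values: "kappa_term x i \<in> {0, 1, - 1, \<i>, - \<i>}"
  unfolding kappa_term_def cnj_chi4 chi4_mult[symmetric] by (rule chi4_values)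

lemma sum_kappa_term:
  assumes "x \<noteq> 0"
  shows "(\<Sum>i<N. kappa_term x i) = of_nat q * \<chi>\<^sub>2 x * \<chi>\<^sub>2 (trace x)"
proof -
  have "(\<Sum>y\<in>UNIV - {0}. twisted_term x y)
      = (\<Sum>(c, i)\<in>(F - {0}) \<times> {..<N}. twisted_term x (c * \<mu> ^ i))"
    using sum.reindex_bij_betw[OF bij_units_times_mu_powers, of "twisted_term x"]
    by (simp add: case_prod_beta)
  also have "\<dots> = (\<Sum>c\<in>F - {0}. \<Sum>i<N. twisted_term x (c * \<mu> ^ i))"
    by (rule sum.cartesian_product[symmetric])
  also have "\<dots> = of_nat (q - 1) * (\<Sum>i<N. kappa_term x i)"
    by (simp add: twisted_term_scale twisted_term_mu_power card_F card_Diff_singleton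
        del: One_nat_def)
  finally have "of_nat (q - 1) * (\<Sum>i<N. kappa_term x i)
      = of_nat (q - 1) * (of_nat q * \<chi>\<^sub>2 x * \<chi>\<^sub>2 (trace x))"
    using sum_twisted_term[OF assms] by (simp only:)
  moreover have "of_nat (q - 1) \<noteq> (0::complex)" using q_gt_1 by simp
  ultimately show ?thesis by (metis mult_left_cancel)
qed

lemma trace3_eq_trace: "trace3 q = trace"
  by (rule ext) (simp add: trace3_def trace_eq power2_eq_square power_mult)

lemma kappa_difference_eq_Re_sum:
  "real (kappa q \<alpha> 1 x) - real (kappa q \<alpha> (- 1) x) = Re (\<Sum>i<N. kappa_term x i)"
proof -
  have "kappa q \<alpha> z x = card {i. i < N \<and> kappa_term x i = z}" for z
    by (simp only: kappa_def kappa_term_def N_def trace3_eq_trace Let_def)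
  then have "real (kappa q \<alpha> z x) = (\<Sum>i<N. if kappa_term x i = z then 1 else 0)" for z
    by (simp add: sum.If_cases Int_def)
  then have "real (kappa q \<alpha> 1 x) - real (kappa q \<alpha> (- 1) x)
      = (\<Sum>i<N. (if kappa_term x i = 1 then 1 else 0) - (if kappa_term x i = - 1 then 1 else 0))"
    by (simp add: sum_subtractf)
  also have "\<dots> = (\<Sum>i<N. Re (kappa_term x i))"
  proof (rule sum.cong[OF refl])
    fix i
    show "(if kappa_term x i = 1 then 1 else 0) - (if kappa_term x i = - 1 then 1 else 0)
        = Re (kappa_term x i)"
      using kappa_term_values[of x i] by (auto simp: complex_eq_iff)
  qed
  finally show ?thesis by simp
qed

lemma kappa_difference:
  assumes "x \<noteq> 0"
  shows "of_nat (kappa q \<alpha> 1 x) - of_nat (kappa q \<alpha> (- 1) x) = of_nat q * \<chi>\<^sub>2 x * \<chi>\<^sub>2 (trace3 q x)"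
proof -
  have "\<chi>\<^sub>2 y \<in> \<real>" for y
    using E.eta_cases[of y] by (cases "y = 0") auto
  then have real_sum: "(\<Sum>i<N. kappa_term x i) \<in> \<real>" by (simp add: sum_kappa_term[OF assms])
  have "of_nat (kappa q \<alpha> 1 x) - of_nat (kappa q \<alpha> (- 1) x)
      = complex_of_real (Re (\<Sum>i<N. kappa_term x i))"
    unfolding kappa_difference_eq_Re_sum[symmetric] by simp
  also have "\<dots> = of_nat q * \<chi>\<^sub>2 x * \<chi>\<^sub>2 (trace3 q x)"
    unfolding of_real_Re[OF real_sum] trace3_eq_trace by (rule sum_kappa_term[OF assms])
  finally show ?thesis .
qed

end

theorem mainTheorem6:
  fixes q :: nat and \<alpha> x :: "'a::{field,finite}"
  assumes "primepow q" and "[q = 1] (mod 4)" and "\<not> [q = 1] (mod 3)"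
    and "CARD('a) = q ^ 3"
    and "primitive_element \<alpha>"
    and "x \<noteq> 0"
  shows "of_nat (kappa q \<alpha> 1 x) - of_nat (kappa q \<alpha> (- 1) x)
       = of_nat q * chi2 \<alpha> x * chi2 \<alpha> (trace3 q x)"
proof -
  obtain n where n: "q = CHAR('a) ^ n"
    using primepow_root_CARD_eq_CHAR_power[OF assms(1,4)] by blast
  then obtain \<psi> :: "'a \<Rightarrow> complex" where \<psi>: "nontrivial_additive_character UNIV \<psi>" "\<psi> 1 \<noteq> 1"
    using exists_nontrivial_additive_character[of "n * 3", where 'a='a] assms(4)
    by (auto simp: power_mult)
  define F where "F = {t::'a. t ^ q = t}"
  interpret finite_extension q 3 F
    using n assms(4) by unfold_locales (auto simp: F_def)
  interpret quartic_character \<alpha>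
    using assms(5) cong_pow[OF assms(2), of 3] by unfold_locales (simp_all add: assms(4))
  interpret \<psi>: nontrivial_additive_character UNIV \<psi> by (rule \<psi>(1))
  interpret cubic_quartic_character \<alpha> q F \<psi>
    using assms \<psi>(2) by unfold_locales (auto simp: \<psi>.psi_add intro: F.one_closed)
  show ?thesis by (rule kappa_difference[OF assms(6)])
qed

end
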